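(* For every integer $n\ge 2$, $$D^{\mathrm{VR}}_{4,1}(\mathbb R^n)=\{(t_b,t_d):0<t_b<t_d\le\sqrt2\,t_b\}\quad\text{and}\quad D^{\mathrm{VR}}_{4,1}(\mathbb S^n_E)=\{(t_b,t_d):0<t_b<t_d\le\min(\sqrt2\,t_b,2)\}.$$ In particular, both sets are convex.
   Context: $\mathbb R^n$ carries the Euclidean metric, and $\mathbb S^n_E$ is the unit sphere in $\mathbb R^{n+1}$ with the (restricted) Euclidean metric. For a finite metric space $Y$ and $r\ge 0$, $\mathrm{VR}_r(Y)$ is the simplicial complex of nonempty subsets $\sigma\subset Y$ with $\mathrm{diam}(\sigma)\le r$. With a fixed coefficient field $\mathbb F$, the persistence module $r\mapsto\widetilde H_1(\mathrm{VR}_r(Y);\mathbb F)$ decomposes into finitely many interval modules on intervals $[b_\alpha,d_\alpha)$, and $\mathrm{dgm}_1^{\mathrm{VR}}(Y)$ is the multiset of points $(b_\alpha,d_\alpha)$. If $|Y|\le 4$ this diagram has at most one point. For a metric space $X$, $D^{\mathrm{VR}}_{4,1}(X)$ is identified with the subset of $\mathbb R^2$ of all $(t_b,t_d)$ such that $\mathrm{dgm}_1^{\mathrm{VR}}(X')=\{(t_b,t_d)\}$ for some $X'\subset X$ with $|X'|\le 4$ (the empty diagram is omitted by convention). *)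

theory Defs
  imports "HOL-Analysis.Analysis" "HOL-Library.Multiset"
begin

section \<open>Simplicial homology with field coefficients\<close>

text \<open>
  A simplicial complex \<open>K\<close> is given by its set of (nonempty, finite) simplices.
  Oriented simplicial chains are encoded as alternating functions on ordered simplices: the
  oriented simplex \<open>[v\<^sub>0, \<dots>, v\<^sub>k]\<close> is the function sending each reordering of
  \<open>v\<^sub>0, \<dots>, v\<^sub>k\<close> to its sign and every other list to 0. The parameter \<open>m\<close> is the number of
  vertices, so \<open>chains K (k + 1)\<close> is the chain space in degree \<open>k\<close>, and \<open>chains K 0\<close>, the scalars
  on the empty simplex, is the degree \<open>-1\<close> term of the augmented complex. Requiring
  \<open>distinct xs\<close> makes the definition correct in characteristic 2 as well.
\<close>

definition chains :: "'a set set \<Rightarrow> nat \<Rightarrow> ('a list \<Rightarrow> 'f::field) set" where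
  "chains K m = {c.
     (\<forall>xs. c xs \<noteq> 0 \<longrightarrow> length xs = m \<and> distinct xs \<and> set xs \<in> insert {} K) \<and>
     (\<forall>us x y vs. c (us @ x # y # vs) = - c (us @ y # x # vs))}"

text \<open>
  Moving \<open>v\<^sub>i\<close> to the front of \<open>[v\<^sub>0, \<dots>, v\<^sub>k]\<close> has sign \<open>(-1)\<^sup>i\<close>, so this is the usual
  alternating sum of faces. On \<open>chains K 1\<close> it is the augmentation.
\<close>

definition boundary :: "'a set set \<Rightarrow> ('a list \<Rightarrow> 'f::field) \<Rightarrow> 'a list \<Rightarrow> 'f" where
  "boundary K c = (\<lambda>xs. \<Sum>v\<in>\<Union>K. c (v # xs))"

definition cycles :: "'a set set \<Rightarrow> nat \<Rightarrow> ('a list \<Rightarrow> 'f::field) set" where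
  "cycles K k = {c \<in> chains K (k + 1). boundary K c = (\<lambda>_. 0)}"

definition boundaries :: "'a set set \<Rightarrow> nat \<Rightarrow> ('a list \<Rightarrow> 'f::field) set" where
  "boundaries K k = boundary K ` chains K (k + 2)"

definition homology_class ::
    "'a set set \<Rightarrow> nat \<Rightarrow> ('a list \<Rightarrow> 'f::field) \<Rightarrow> ('a list \<Rightarrow> 'f) set" where
  "homology_class K k c = {c' \<in> cycles K k. (\<lambda>xs. c' xs - c xs) \<in> boundaries K k}"

definition reduced_homology :: "'a set set \<Rightarrow> nat \<Rightarrow> ('a list \<Rightarrow> 'f::field) set set" where
  "reduced_homology K k = homology_class K k ` cycles K k"


section \<open>Persistence modules\<close>

text \<open>
  Persistence modules indexed by the real numbers \<open>r \<ge> 0\<close>: \<open>pm_map M r s\<close>, for \<open>r \<le> s\<close>, is the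
  structure map from \<open>pm_space M r\<close> to \<open>pm_space M s\<close>. The operations are only relevant on these
  carriers.
\<close>

record ('f, 'v) persistence_module =
  pm_space :: "real \<Rightarrow> 'v set"
  pm_add :: "real \<Rightarrow> 'v \<Rightarrow> 'v \<Rightarrow> 'v"
  pm_scale :: "real \<Rightarrow> 'f \<Rightarrow> 'v \<Rightarrow> 'v"
  pm_map :: "real \<Rightarrow> real \<Rightarrow> 'v \<Rightarrow> 'v"

definition pm_isomorphic ::
    "('f, 'v) persistence_module \<Rightarrow> ('f, 'w) persistence_module \<Rightarrow> bool" where
  "pm_isomorphic M N \<longleftrightarrow> (\<exists>\<phi>. \<forall>r\<ge>0.
     bij_betw (\<phi> r) (pm_space M r) (pm_space N r) \<and>
     (\<forall>x\<in>pm_space M r. \<forall>y\<in>pm_space M r.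
        \<phi> r (pm_add M r x y) = pm_add N r (\<phi> r x) (\<phi> r y)) \<and>
     (\<forall>a. \<forall>x\<in>pm_space M r. \<phi> r (pm_scale M r a x) = pm_scale N r a (\<phi> r x)) \<and>
     (\<forall>s\<ge>r. \<forall>x\<in>pm_space M r. \<phi> s (pm_map M r s x) = pm_map N r s (\<phi> r x)))"

text \<open>The interval module on the half-open interval \<open>[b, d)\<close>.\<close>

definition interval_module :: "real \<times> real \<Rightarrow> ('f::field, 'f) persistence_module" where
  "interval_module = (\<lambda>(b, d). \<lparr>
     pm_space = (\<lambda>r. if r \<in> {b..<d} then UNIV else {0}),
     pm_add = (\<lambda>r x y. x + y),
     pm_scale = (\<lambda>r a x. a * x),
     pm_map = (\<lambda>r s x. if r \<in> {b..<d} \<and> s \<in> {b..<d} then x else 0)\<rparr>)"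

text \<open>The direct sum over an index set \<open>I\<close>, which is meant to be finite.\<close>

definition pm_direct_sum ::
    "'i set \<Rightarrow> ('i \<Rightarrow> ('f, 'v) persistence_module) \<Rightarrow> ('f, 'i \<Rightarrow> 'v) persistence_module" where
  "pm_direct_sum I M = \<lparr>
     pm_space = (\<lambda>r. \<Pi>\<^sub>E i\<in>I. pm_space (M i) r),
     pm_add = (\<lambda>r x y. \<lambda>i\<in>I. pm_add (M i) r (x i) (y i)),
     pm_scale = (\<lambda>r a x. \<lambda>i\<in>I. pm_scale (M i) r a (x i)),
     pm_map = (\<lambda>r s x. \<lambda>i\<in>I. pm_map (M i) r s (x i))\<rparr>"

text \<open>
  \<open>B\<close> is the diagram of \<open>M\<close> if \<open>M\<close> is isomorphic to the direct sum of the interval modules on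
  the \<open>[b, d)\<close> with \<open>(b, d)\<close> in \<open>B\<close>. A point \<open>p\<close> of multiplicity \<open>count B p\<close> contributes the
  indices \<open>(p, i)\<close> with \<open>i < count B p\<close>.
\<close>

definition has_diagram ::
    "('f::field, 'v) persistence_module \<Rightarrow> (real \<times> real) multiset \<Rightarrow> bool" where
  "has_diagram M B \<longleftrightarrow>
     (\<forall>(b, d)\<in>#B. 0 \<le> b \<and> b < d) \<and>
     pm_isomorphic M
       (pm_direct_sum {(p, i). i < count B p} (\<lambda>(p, i :: nat). interval_module p))"


section \<open>Vietoris--Rips persistence\<close>

definition VR :: "'a::metric_space set \<Rightarrow> real \<Rightarrow> 'a set set" where
  "VR Y r = {\<sigma>. \<sigma> \<noteq> {} \<and> \<sigma> \<subseteq> Y \<and> diameter \<sigma> \<le> r}"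

text \<open>
  Homology classes are cosets, and each operation is defined through representatives; since the
  result does not depend on them, each of the unions below is a union of equal cosets. The
  structure maps are induced by the inclusions of complexes.
\<close>

definition VR_persistence ::
    "nat \<Rightarrow> 'a::metric_space set \<Rightarrow> ('f::field, ('a list \<Rightarrow> 'f) set) persistence_module" where
  "VR_persistence k Y = \<lparr>
     pm_space = (\<lambda>r. reduced_homology (VR Y r) k),
     pm_add = (\<lambda>r A A'. \<Union>c\<in>A. \<Union>c'\<in>A'. homology_class (VR Y r) k (\<lambda>xs. c xs + c' xs)),
     pm_scale = (\<lambda>r a A. \<Union>c\<in>A. homology_class (VR Y r) k (\<lambda>xs. a * c xs)),
     pm_map = (\<lambda>r s A. \<Union>c\<in>A. homology_class (VR Y s) k c)\<rparr>"

text \<open>The diagrams in degree \<open>k\<close> of all subsets of \<open>X\<close> with at most \<open>m\<close> points.\<close>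

definition VR_diagrams ::
    "'f::field itself \<Rightarrow> nat \<Rightarrow> nat \<Rightarrow> 'a::metric_space set \<Rightarrow> (real \<times> real) multiset set" where
  "VR_diagrams F m k X = {B. \<exists>X'\<subseteq>X. finite X' \<and> card X' \<le> m \<and>
     has_diagram (VR_persistence k X' :: ('f, ('a list \<Rightarrow> 'f) set) persistence_module) B}"

definition D_VR_4_1 :: "'f::field itself \<Rightarrow> 'a::metric_space set \<Rightarrow> (real \<times> real) set" where
  "D_VR_4_1 F X = {(t_b, t_d). {#(t_b, t_d)#} \<in> VR_diagrams F 4 1 X}"

end

theory Submission
  imports Defs
begin

text \<open>
  On at most four vertices the neighbourhood graph carries first homology only if it is a 4-cycle:
  otherwise some vertex is isolated or dominated by another one, and a cycle can be pushed off it.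
  A 4-cycle has one-dimensional homology and no triangles, so it persists exactly from the longest
  side \<open>b\<close> up to the shorter diagonal \<open>d\<close>. In an inner product space
  \<open>|p - s|\<^sup>2 + |q - t|\<^sup>2\<close> is at most the sum of the squared sides, whence \<open>2 d\<^sup>2 \<le> 4 b\<^sup>2\<close>.
  All remaining pairs are realised by rectangles with longer side \<open>b\<close> and diagonal \<open>d\<close>, which
  fit into the unit sphere as long as \<open>d \<le> 2\<close>.
\<close>

section \<open>Chains of Vietoris--Rips complexes\<close>

text \<open>\<open>diameter\<close> is a supremum, so it controls pairwise distances only on bounded
  sets; subsets of a finite \<open>Y\<close> are bounded.\<close>

lemma mem_VR_iff:
  assumes "finite Y" "0 \<le> r"
  shows "\<sigma> \<in> VR Y r \<longleftrightarrow> \<sigma> \<noteq> {} \<and> \<sigma> \<subseteq> Y \<and> (\<forall>x\<in>\<sigma>. \<forall>y\<in>\<sigma>. dist x y \<le> r)"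
proof -
  have "diameter \<sigma> \<le> r \<longleftrightarrow> (\<forall>x\<in>\<sigma>. \<forall>y\<in>\<sigma>. dist x y \<le> r)" if "\<sigma> \<noteq> {}" "\<sigma> \<subseteq> Y"
  proof
    assume "diameter \<sigma> \<le> r"
    moreover have "bounded \<sigma>"
      using that assms by (meson finite_imp_bounded finite_subset)
    ultimately show "\<forall>x\<in>\<sigma>. \<forall>y\<in>\<sigma>. dist x y \<le> r"
      using diameter_bounded_bound by fastforce
  next
    assume close: "\<forall>x\<in>\<sigma>. \<forall>y\<in>\<sigma>. dist x y \<le> r"
    show "diameter \<sigma> \<le> r"
      unfolding diameter_def using that close by (auto intro!: cSUP_least)
  qed
  then show ?thesis
    by (auto simp: VR_def)
qed

lemma Union_VR:
  assumes "finite Y" "0 \<le> r"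
  shows "\<Union>(VR Y r) = Y"
proof -
  have "{y} \<in> VR Y r" if "y \<in> Y" for y
    using that assms by (simp add: mem_VR_iff)
  moreover have "\<sigma> \<subseteq> Y" if "\<sigma> \<in> VR Y r" for \<sigma>
    using that by (simp add: VR_def)
  ultimately show ?thesis
    by blast
qed

text \<open>For \<open>r >= 0\<close> every point is already a vertex, so the boundary is given by
  the same formula at all scales.\<close>

lemma boundary_VR:
  assumes "finite Y" "0 \<le> r"
  shows "boundary (VR Y r) c = (\<lambda>xs. \<Sum>v\<in>Y. c (v # xs))"
  by (simp add: boundary_def Union_VR[OF assms])

section \<open>Linear structure of chains and cycles\<close>

lemma boundary_add: "boundary K (\<lambda>xs. c xs + c' xs) = (\<lambda>xs. boundary K c xs + boundary K c' xs)"
  by (simp add: boundary_def sum.distrib)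

lemma boundary_diff: "boundary K (\<lambda>xs. c xs - c' xs) = (\<lambda>xs. boundary K c xs - boundary K c' xs)"
  by (simp add: boundary_def sum_subtractf)

lemma boundary_scale: "boundary K (\<lambda>xs. a * c xs) = (\<lambda>xs. a * boundary K c xs)"
  by (simp add: boundary_def sum_distrib_left)

lemma chains_support:
  assumes "c \<in> chains K m" "c xs \<noteq> 0"
  shows "length xs = m" "distinct xs" "set xs \<in> insert {} K"
  using assms unfolding chains_def by blast+

lemma chains_swap: "c \<in> chains K m \<Longrightarrow> c (us @ x # y # vs) = - c (us @ y # x # vs)"
  unfolding chains_def by blast

lemma chains_2_swap: "c \<in> chains K m \<Longrightarrow> c [x, y] = - c [y, x]"
  using chains_swap[of c K m "[]" x y "[]"] by simp

lemma chains_VR_dist: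
  assumes "c \<in> chains (VR Y r) m" "finite Y" "0 \<le> r" "c xs \<noteq> 0" "x \<in> set xs" "y \<in> set xs"
  shows "x \<in> Y" "dist x y \<le> r"
  using chains_support(3)[OF assms(1,4)] assms by (auto simp: mem_VR_iff)

lemma chains_add:
  assumes "c \<in> chains K m" "c' \<in> chains K m"
  shows "(\<lambda>xs. c xs + c' xs) \<in> chains K m"
proof -
  have "length xs = m \<and> distinct xs \<and> set xs \<in> insert {} K" if "c xs + c' xs \<noteq> 0" for xs
  proof -
    have "c xs \<noteq> 0 \<or> c' xs \<noteq> 0"
      using that by auto
    then show ?thesis
      using chains_support assms by meson
  qed
  moreover have "c (us @ x # y # vs) + c' (us @ x # y # vs)
      = - (c (us @ y # x # vs) + c' (us @ y # x # vs))" for us x y vs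
    using chains_swap[OF assms(1), of us x y vs] chains_swap[OF assms(2), of us x y vs] by simp
  ultimately show ?thesis
    unfolding chains_def by blast
qed

lemma chains_scale:
  assumes "c \<in> chains K m"
  shows "(\<lambda>xs. a * c xs) \<in> chains K m"
proof -
  have "length xs = m \<and> distinct xs \<and> set xs \<in> insert {} K" if "a * c xs \<noteq> 0" for xs
    using that chains_support[OF assms, of xs] by auto
  moreover have "a * c (us @ x # y # vs) = - (a * c (us @ y # x # vs))" for us x y vs
    using chains_swap[OF assms, of us x y vs] by simp
  ultimately show ?thesis
    unfolding chains_def by blast
qed

lemma chains_diff:
  assumes "c \<in> chains K m" "c' \<in> chains K m"
  shows "(\<lambda>xs. c xs - c' xs) \<in> chains K m"
  using chains_add[OF assms(1) chains_scale[OF assms(2), of "-1"]] by simp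

lemma zero_mem_chains: "(\<lambda>_. 0) \<in> chains K m"
  by (simp add: chains_def)

lemma cycles_add: "c \<in> cycles K k \<Longrightarrow> c' \<in> cycles K k \<Longrightarrow> (\<lambda>xs. c xs + c' xs) \<in> cycles K k"
  by (simp add: cycles_def chains_add boundary_add)

lemma cycles_diff: "c \<in> cycles K k \<Longrightarrow> c' \<in> cycles K k \<Longrightarrow> (\<lambda>xs. c xs - c' xs) \<in> cycles K k"
  by (simp add: cycles_def chains_diff boundary_diff)

lemma cycles_scale: "c \<in> cycles K k \<Longrightarrow> (\<lambda>xs. a * c xs) \<in> cycles K k"
  by (simp add: cycles_def chains_scale boundary_scale)

lemma zero_mem_cycles: "(\<lambda>_. 0) \<in> cycles K k"
  by (simp add: cycles_def zero_mem_chains boundary_def)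

section \<open>Change of vertex set and scale\<close>

lemma chains_mono: "K \<subseteq> L \<Longrightarrow> chains K m \<subseteq> chains L m"
  unfolding chains_def by blast

lemma VR_mono: "Y' \<subseteq> Y \<Longrightarrow> r \<le> s \<Longrightarrow> VR Y' r \<subseteq> VR Y s"
  unfolding VR_def by force

text \<open>A chain vanishes on lists that meet the complement of its vertex set, so the additional
  summands are zero. This serves both for deleting a vertex and for changing the scale.\<close>

lemma boundary_chains_VR_subset:
  assumes "c \<in> chains (VR Y' r) m" "Y' \<subseteq> Y" "finite Y" "0 \<le> r" "0 \<le> s"
  shows "boundary (VR Y s) c = boundary (VR Y' r) c"
proof
  fix xs
  have fin: "finite Y'"
    using assms finite_subset by blast
  have "c (v # xs) = 0" if "v \<notin> Y'" for v
    using chains_VR_dist(1)[OF assms(1) fin assms(4), of "v # xs" v] that by auto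
  then have "(\<Sum>v\<in>Y. c (v # xs)) = (\<Sum>v\<in>Y'. c (v # xs))"
    by (intro sum.mono_neutral_right) (use assms in auto)
  then show "boundary (VR Y s) c xs = boundary (VR Y' r) c xs"
    using fin assms by (simp add: boundary_VR)
qed

lemma boundaries_VR_subset:
  assumes "Y' \<subseteq> Y" "finite Y" "0 \<le> r"
  shows "boundaries (VR Y' r) k \<subseteq> boundaries (VR Y r) k"
  unfolding boundaries_def
  using boundary_chains_VR_subset[OF _ assms assms(3)] chains_mono[OF VR_mono[OF assms(1) order_refl]]
  by (smt (verit, ccfv_SIG) image_iff subset_iff)

lemma cycles_VR_mono:
  assumes "finite Y" "0 \<le> r" "r \<le> s"
  shows "cycles (VR Y r) k \<subseteq> cycles (VR Y s) k"
proof
  fix c :: "'a list \<Rightarrow> 'b" assume c: "c \<in> cycles (VR Y r) k"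
  then have "boundary (VR Y s) c = boundary (VR Y r) c"
    by (intro boundary_chains_VR_subset) (use assms in \<open>auto simp: cycles_def\<close>)
  then show "c \<in> cycles (VR Y s) k"
    using c chains_mono[OF VR_mono[OF order_refl assms(3)]] by (auto simp: cycles_def)
qed

section \<open>The boundary of a boundary vanishes\<close>

lemma boundary_mem_chains:
  assumes "c \<in> chains (VR Y r) (Suc m)" "finite Y" "0 \<le> r"
  shows "boundary (VR Y r) c \<in> chains (VR Y r) m"
proof -
  have "length xs = m \<and> distinct xs \<and> set xs \<in> insert {} (VR Y r)"
    if nz: "(\<Sum>v\<in>Y. c (v # xs)) \<noteq> 0" for xs
  proof -
    obtain v where "c (v # xs) \<noteq> 0"
      using nz by (metis (no_types, lifting) sum.neutral)
    then show ?thesis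
      using chains_support[OF assms(1), of "v # xs"] assms by (auto simp: mem_VR_iff)
  qed
  moreover have "(\<Sum>v\<in>Y. c (v # us @ x # y # vs)) = - (\<Sum>v\<in>Y. c (v # us @ y # x # vs))" for us x y vs
    unfolding sum_negf[symmetric]
    using chains_swap[OF assms(1), of "_ # us" x y vs] by (intro sum.cong) auto
  ultimately show ?thesis
    unfolding boundary_VR[OF assms(2,3)] chains_def by blast
qed

text \<open>The vanishing on the diagonal is not implied by antisymmetry in characteristic 2.\<close>

lemma sum_antisymmetric_eq_0:
  fixes f :: "'a \<Rightarrow> 'a \<Rightarrow> 'b::ab_group_add"
  assumes "finite Y" "\<And>x y. f x y = - f y x" "\<And>x. f x x = 0"
  shows "(\<Sum>x\<in>Y. \<Sum>y\<in>Y. f x y) = 0"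
  using assms(1)
proof induction
  case (insert a Y)
  have "(\<Sum>x\<in>Y. f x a) = - (\<Sum>x\<in>Y. f a x)"
    unfolding sum_negf[symmetric] by (intro sum.cong refl assms(2))
  then show ?case
    using insert by (simp add: sum.distrib assms(3))
qed simp

text \<open>Applying the boundary twice sums \<open>c\<close> over all ordered pairs of leading
  vertices; this double sum is antisymmetric, and zero on the diagonal because chains live on
  distinct lists.\<close>

lemma boundary_mem_cycles:
  assumes "c \<in> chains (VR Y r) (k + 2)" "finite Y" "0 \<le> r"
  shows "boundary (VR Y r) c \<in> cycles (VR Y r) k"
proof -
  have "(\<Sum>v\<in>Y. \<Sum>w\<in>Y. c (w # v # xs)) = 0" for xs
  proof (rule sum_antisymmetric_eq_0[OF assms(2)])
    show "c (w # v # xs) = - c (v # w # xs)" for v w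
      using chains_swap[OF assms(1), of "[]" w v xs] by simp
    show "c (v # v # xs) = 0" for v
      using chains_support(2)[OF assms(1), of "v # v # xs"] by auto
  qed
  then show ?thesis
    using assms boundary_mem_chains[of c Y r "k + 1"] by (simp add: cycles_def boundary_VR)
qed

section \<open>Vanishing of the first homology\<close>

lemma cycles_VR_remove:
  assumes "z \<in> cycles (VR Y r) k" "finite Y" "0 \<le> r" "\<And>xs. w \<in> set xs \<Longrightarrow> z xs = 0"
  shows "z \<in> cycles (VR (Y - {w}) r) k"
proof -
  have z: "z \<in> chains (VR Y r) (k + 1)"
    using assms(1) by (simp add: cycles_def)
  have "length xs = k + 1 \<and> distinct xs \<and> set xs \<in> insert {} (VR (Y - {w}) r)" if "z xs \<noteq> 0" for xs
    using chains_support[OF z that] assms(4)[of xs] that by (auto simp: VR_def)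
  then have z': "z \<in> chains (VR (Y - {w}) r) (k + 1)"
    using chains_swap[OF z] unfolding chains_def by blast
  then show ?thesis
    using boundary_chains_VR_subset[OF z', of Y r] assms by (auto simp: cycles_def)
qed

text \<open>Three entries admit only two adjacent transpositions, so two identities for
  \<open>f\<close> suffice; lists of any other length have the value 0 on both sides.\<close>

lemma alternating_3I:
  fixes f :: "'a \<Rightarrow> 'a \<Rightarrow> 'a \<Rightarrow> 'b::field"
  assumes "\<And>x y z. f x y z = - f y x z" "\<And>x y z. f x y z = - f x z y"
    and "c = (\<lambda>xs. case xs of [x, y, z] \<Rightarrow> f x y z | _ \<Rightarrow> 0)"
  shows "c (us @ x # y # vs) = - c (us @ y # x # vs)"
proof -
  consider z where "us = []" "vs = [z]" | z where "us = [z]" "vs = []"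
    | "length (us @ x # y # vs) \<noteq> 3"
  proof (cases "length (us @ x # y # vs) = 3")
    case True
    then show thesis
      using that by (cases us; cases vs) (auto simp: length_Suc_conv)
  qed
  then show ?thesis
  proof cases
    case (1 z)
    then show ?thesis
      using assms(1)[of x y z] by (simp add: assms(3))
  next
    case (2 z)
    then show ?thesis
      using assms(2)[of z x y] by (simp add: assms(3))
  next
    case 3
    have "c xs = 0" if "length xs \<noteq> 3" for xs
      using that unfolding assms(3) by (auto split: list.splits)
    from this[of "us @ x # y # vs"] this[of "us @ y # x # vs"] 3 show ?thesis
      by simp
  qed
qed

text \<open>Coning the part of a cycle at \<open>w\<close> off to \<open>v\<close> removes \<open>w\<close> from the support.\<close>

lemma cycles_subset_boundaries_dominated:
  fixes Y :: "'a::metric_space set"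
  assumes Y: "finite Y" "0 \<le> r" and vw: "v \<in> Y" "w \<in> Y" "v \<noteq> w"
    and dom: "\<And>x. x \<in> Y \<Longrightarrow> dist w x \<le> r \<Longrightarrow> dist v x \<le> r"
    and triv: "cycles (VR (Y - {w}) r) 1
      \<subseteq> (boundaries (VR (Y - {w}) r) 1 :: ('a list \<Rightarrow> 'f::field) set)"
  shows "cycles (VR Y r) 1 \<subseteq> (boundaries (VR Y r) 1 :: ('a list \<Rightarrow> 'f) set)"
proof
  fix z :: "'a list \<Rightarrow> 'f" assume cyc: "z \<in> cycles (VR Y r) 1"
  then have z: "z \<in> chains (VR Y r) 2"
    by (simp add: cycles_def numeral_2_eq_2)
  have bz: "(\<Sum>p\<in>Y. z [p, q]) = 0" for q
    using cyc Y by (simp add: cycles_def boundary_VR fun_eq_iff)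
  note anti = chains_2_swap[OF z]
  \<comment> \<open>\<open>g\<close> is the part of \<open>z\<close> on the edges at
    \<open>w\<close> other than the edge to \<open>v\<close>, and \<open>f\<close> is the cone over
    it with apex \<open>v\<close>. Since \<open>g\<close> vanishes at \<open>v\<close>, at most one
    of the three terms of \<open>f\<close> is nonzero.\<close>
  define g where "g q s = (if q = v \<or> s = v \<or> q \<noteq> w \<and> s \<noteq> w then 0 else z [q, s])" for q s
  define f where "f p q s = (if p = v then g q s else 0) - (if q = v then g p s else 0)
    + (if s = v then g p q else 0)" for p q s
  define e where "e = (\<lambda>xs. case xs of [p, q, s] \<Rightarrow> f p q s | _ \<Rightarrow> 0)"
  have g_anti: "g q s = - g s q" for q s
    unfolding g_def using anti[of q s] by auto
  \<comment> \<open>The point \<open>w\<close> is within distance \<open>r\<close> of itself, so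
    domination gives the edge from \<open>v\<close> to \<open>w\<close>; the remaining vertex is a
    neighbour of \<open>w\<close>, hence of \<open>v\<close>.\<close>
  have g_nz: "distinct [v, q, s] \<and> {v, q, s} \<in> VR Y r" if "g q s \<noteq> 0" for q s
  proof -
    have qs: "q \<noteq> v" "s \<noteq> v" "q = w \<or> s = w" and nz: "z [q, s] \<noteq> 0"
      using that by (auto simp: g_def split: if_splits)
    have "q \<in> Y" "s \<in> Y" "dist q s \<le> r" "q \<noteq> s"
      using chains_VR_dist[OF z Y nz] chains_support(2)[OF z nz] by auto
    moreover have "dist v w \<le> r"
      using dom[of w] vw Y by simp
    ultimately show ?thesis
      using qs dom[of q] dom[of s] vw Y by (auto simp: mem_VR_iff dist_commute)
  qed
  have f_nz: "distinct [p, q, s] \<and> {p, q, s} \<in> VR Y r" if "f p q s \<noteq> 0" for p q s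
  proof -
    have "p = v \<and> g q s \<noteq> 0 \<or> q = v \<and> g p s \<noteq> 0 \<or> s = v \<and> g p q \<noteq> 0"
      using that unfolding f_def by (auto split: if_splits)
    then show ?thesis
      using g_nz[of q s] g_nz[of p s] g_nz[of p q] by (auto simp: insert_commute)
  qed
  have "e (us @ x # y # vs) = - e (us @ y # x # vs)" for us x y vs
  proof (rule alternating_3I[OF _ _ e_def])
    show "f a b c = - f b a c" for a b c
      unfolding f_def using g_anti[of a b] by auto
    show "f a b c = - f a c b" for a b c
      unfolding f_def using g_anti[of b c] by auto
  qed
  moreover have "length xs = 3 \<and> distinct xs \<and> set xs \<in> insert {} (VR Y r)" if "e xs \<noteq> 0" for xs
    using that f_nz by (auto simp: e_def split: list.splits)
  ultimately have e: "e \<in> chains (VR Y r) 3"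
    unfolding chains_def by blast
  define z' where "z' = (\<lambda>xs. z xs - boundary (VR Y r) e xs)"
  have z'_cyc: "z' \<in> cycles (VR Y r) 1"
    unfolding z'_def
    by (intro cycles_diff cyc boundary_mem_cycles) (use e Y in \<open>simp_all add: numeral_3_eq_3\<close>)
  then have z': "z' \<in> chains (VR Y r) 2"
    by (simp add: cycles_def numeral_2_eq_2)
  \<comment> \<open>The boundary of a cone is its base minus the cone over the boundary of the
    base.\<close>
  have be: "boundary (VR Y r) e [q, s] = g q s - (if q = v then \<Sum>p\<in>Y. g p s else 0)
      + (if s = v then \<Sum>p\<in>Y. g p q else 0)" for q s
    using Y vw by (simp add: boundary_VR e_def f_def sum.distrib sum_subtractf)
  have z'_w: "z' [w, s] = 0" for s
  proof (cases "s = v")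
    case True
    \<comment> \<open>For \<open>s = v\<close> the base contributes nothing, and the cycle condition
      at \<open>w\<close> supplies the cancellation; for \<open>s\<close> other than
      \<open>v\<close> the base \<open>g\<close> alone cancels \<open>z\<close>.\<close>
    have "(\<Sum>p\<in>Y. g p w) = (\<Sum>p\<in>Y - {v}. z [p, w])"
      unfolding g_def using Y vw by (intro sum.mono_neutral_cong_right) auto
    also have "\<dots> = - z [v, w]"
      using bz[of w] Y vw by (simp add: sum_diff1)
    also have "\<dots> = z [w, v]"
      using anti[of w v] by simp
    finally show ?thesis
      using True vw by (simp add: z'_def be) (simp add: g_def)
  next
    case False
    then show ?thesis
      using vw by (simp add: z'_def be) (simp add: g_def)
  qed
  have "z' xs = 0" if "w \<in> set xs" for xs
  proof (rule ccontr)
    assume nz: "z' xs \<noteq> 0"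
    then obtain q s where xs: "xs = [q, s]"
      using chains_support(1)[OF z' nz] by (auto simp: length_Suc_conv numeral_2_eq_2)
    then show False
      using nz that z'_w[of q] z'_w[of s] chains_2_swap[OF z', of q s] by auto
  qed
  then have "z' \<in> cycles (VR (Y - {w}) r) 1"
    using cycles_VR_remove[OF z'_cyc Y] by blast
  then have "z' \<in> boundaries (VR Y r) 1"
    using triv boundaries_VR_subset[of "Y - {w}" Y r 1] Y by blast
  then obtain e' where e': "e' \<in> chains (VR Y r) 3" "z' = boundary (VR Y r) e'"
    by (auto simp: boundaries_def numeral_3_eq_3)
  have "z = boundary (VR Y r) (\<lambda>xs. e' xs + e xs)"
    unfolding boundary_add e'(2)[symmetric] z'_def by simp
  then show "z \<in> boundaries (VR Y r) 1"
    using chains_add[OF e'(1) e] by (auto simp: boundaries_def numeral_3_eq_3)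
qed

text \<open>No edge contains an isolated vertex, so every 1-cycle already lives on the other
  points.\<close>

lemma cycles_subset_boundaries_isolated:
  fixes Y :: "'a::metric_space set"
  assumes Y: "finite Y" "0 \<le> r"
    and isol: "\<And>x. x \<in> Y \<Longrightarrow> x \<noteq> w \<Longrightarrow> r < dist w x"
    and triv: "cycles (VR (Y - {w}) r) 1
      \<subseteq> (boundaries (VR (Y - {w}) r) 1 :: ('a list \<Rightarrow> 'f::field) set)"
  shows "cycles (VR Y r) 1 \<subseteq> (boundaries (VR Y r) 1 :: ('a list \<Rightarrow> 'f) set)"
proof
  fix z :: "'a list \<Rightarrow> 'f" assume cyc: "z \<in> cycles (VR Y r) 1"
  then have z: "z \<in> chains (VR Y r) 2"
    by (simp add: cycles_def numeral_2_eq_2)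
  have "z xs = 0" if "w \<in> set xs" for xs
  proof (rule ccontr)
    assume nz: "z xs \<noteq> 0"
    then obtain q s where xs: "xs = [q, s]"
      using chains_support(1)[OF z nz] by (auto simp: length_Suc_conv numeral_2_eq_2)
    then have "q \<in> Y" "s \<in> Y" "q \<noteq> s" "dist q s \<le> r"
      using chains_VR_dist[OF z Y nz] chains_support(2)[OF z nz] by auto
    then show False
      using that xs isol[of q] isol[of s] by (auto simp: dist_commute)
  qed
  then show "z \<in> boundaries (VR Y r) 1"
    using cycles_VR_remove[OF cyc Y] triv boundaries_VR_subset[of "Y - {w}" Y r 1] Y by blast
qed

text \<open>The neighbourhood graph is a 4-cycle iff every vertex has exactly one non-neighbour.\<close>

definition four_cycle :: "'a::metric_space set \<Rightarrow> real \<Rightarrow> bool" where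
  "four_cycle Y r \<longleftrightarrow> card Y = 4 \<and> (\<forall>x\<in>Y. \<exists>!y. y \<in> Y \<and> r < dist x y)"

text \<open>Take a neighbour \<open>u\<close> of \<open>x\<close>. As neither dominates the other,
  there are a neighbour \<open>t\<close> of \<open>u\<close> far from \<open>x\<close> and a
  neighbour \<open>y\<close> of \<open>x\<close> far from \<open>u\<close>. These four points are
  distinct and hence exhaust \<open>Y\<close>, so \<open>t\<close> is the only point far from
  \<open>x\<close>.\<close>

lemma four_cycleI:
  fixes Y :: "'a::metric_space set"
  assumes Y: "finite Y" "Y \<noteq> {}" "card Y \<le> 4" "0 \<le> r"
    and not_isol: "\<And>w. w \<in> Y \<Longrightarrow> \<exists>x\<in>Y. x \<noteq> w \<and> dist w x \<le> r"
    and not_dom: "\<And>v w. v \<in> Y \<Longrightarrow> w \<in> Y \<Longrightarrow> v \<noteq> w \<Longrightarrow> \<exists>x\<in>Y. dist w x \<le> r \<and> r < dist v x"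
  shows "four_cycle Y r"
proof -
  have "card Y = 4 \<and> (\<exists>!y. y \<in> Y \<and> r < dist x y)" if x: "x \<in> Y" for x
  proof -
    obtain u where u: "u \<in> Y" "u \<noteq> x" "dist x u \<le> r"
      using not_isol[OF x] by blast
    obtain t where t: "t \<in> Y" "r < dist x t"
      using not_dom[OF x u(1)] u(2) by auto
    obtain y where y: "y \<in> Y" "dist x y \<le> r" "r < dist u y"
      using not_dom[OF u(1) x] u(2) by auto
    have "distinct [x, u, y, t]"
      using u t y Y(4) by (auto simp: dist_commute)
    then have card: "card {x, u, y, t} = 4"
      by simp
    then have "Y = {x, u, y, t}"
      using card_seteq[of Y "{x, u, y, t}"] x u t y Y by auto
    then show ?thesis
      using card u t y Y(4) by auto
  qed
  then show ?thesis
    using Y(2) unfolding four_cycle_def by blast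
qed

lemma cycles_subset_boundaries:
  fixes Y :: "'a::metric_space set"
  assumes "finite Y" "card Y \<le> 4" "0 \<le> r" "\<not> four_cycle Y r"
  shows "cycles (VR Y r) 1 \<subseteq> (boundaries (VR Y r) 1 :: ('a list \<Rightarrow> 'f::field) set)"
  using assms
proof (induction rule: finite_psubset_induct)
  case (psubset Y)
  show ?case
  proof (cases "Y = {}")
    case True
    have "c = (\<lambda>_. 0)" if "c \<in> chains (VR Y r) 2" for c :: "'a list \<Rightarrow> 'f"
      using chains_support[OF that] True by (fastforce simp: VR_def)
    moreover have "(\<lambda>_. 0) \<in> (boundaries (VR Y r) 1 :: ('a list \<Rightarrow> 'f) set)"
      unfolding boundaries_def by (rule image_eqI[OF _ zero_mem_chains]) (simp add: boundary_def)
    ultimately show ?thesis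
      by (auto simp: cycles_def numeral_2_eq_2)
  next
    case False
    have less: "cycles (VR (Y - {w}) r) 1
        \<subseteq> (boundaries (VR (Y - {w}) r) 1 :: ('a list \<Rightarrow> 'f) set)" if "w \<in> Y" for w
    proof -
      \<comment> \<open>At most three points remain, so the smaller set cannot be a four-cycle and
        the induction hypothesis always applies.\<close>
      have "card (Y - {w}) < 4"
        using psubset that by (metis card_Diff1_less less_le_trans)
      then show ?thesis
        using psubset that by (intro psubset.IH) (auto simp: four_cycle_def)
    qed
    have "\<exists>w\<in>Y. (\<forall>x\<in>Y. x \<noteq> w \<longrightarrow> r < dist w x)
      \<or> (\<exists>v\<in>Y. v \<noteq> w \<and> (\<forall>x\<in>Y. dist w x \<le> r \<longrightarrow> dist v x \<le> r))"
    proof (rule ccontr)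
      assume neg: "\<not> ?thesis"
      have "four_cycle Y r"
      proof (rule four_cycleI)
        show "\<exists>x\<in>Y. x \<noteq> w \<and> dist w x \<le> r" if "w \<in> Y" for w
          using neg that by (fastforce simp: not_less)
        show "\<exists>x\<in>Y. dist w x \<le> r \<and> r < dist v x" if "v \<in> Y" "w \<in> Y" "v \<noteq> w" for v w
          using neg that by (fastforce simp: not_le)
      qed (use psubset False in auto)
      then show False
        using psubset by blast
    qed
    then obtain w where w: "w \<in> Y" and
      "(\<forall>x\<in>Y. x \<noteq> w \<longrightarrow> r < dist w x)
        \<or> (\<exists>v\<in>Y. v \<noteq> w \<and> (\<forall>x\<in>Y. dist w x \<le> r \<longrightarrow> dist v x \<le> r))"
      by blast
    then show ?thesis
    proof (elim disjE bexE conjE)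
      assume "\<forall>x\<in>Y. x \<noteq> w \<longrightarrow> r < dist w x"
      then show ?thesis
        using psubset.hyps psubset.prems
        by (intro cycles_subset_boundaries_isolated[OF _ _ _ less[OF w]]) auto
    next
      fix v assume v: "v \<in> Y" "v \<noteq> w" and "\<forall>x\<in>Y. dist w x \<le> r \<longrightarrow> dist v x \<le> r"
      then show ?thesis
        using psubset.hyps psubset.prems
        by (intro cycles_subset_boundaries_dominated[OF _ _ v(1) w v(2) _ less[OF w]]) auto
    qed
  qed
qed

text \<open>Homology is a set of cosets, so its vanishing appears as a one-element set whose element
  consists of all cycles.\<close>

lemma reduced_homology_trivial:
  fixes K :: "'a set set"
  assumes "cycles K k \<subseteq> (boundaries K k :: ('a list \<Rightarrow> 'f::field) set)"
  shows "reduced_homology K k = {cycles K k :: ('a list \<Rightarrow> 'f) set}"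
proof -
  have "homology_class K k c = cycles K k" if c: "c \<in> cycles K k" for c :: "'a list \<Rightarrow> 'f"
  proof -
    have "(\<lambda>xs. c' xs - c xs) \<in> boundaries K k" if "c' \<in> cycles K k" for c'
      using assms cycles_diff[OF that c] by (rule subsetD)
    then show ?thesis
      unfolding homology_class_def by blast
  qed
  then show ?thesis
    using zero_mem_cycles[of K k] by (auto simp: reduced_homology_def)
qed

section \<open>The diagram of four points\<close>

lemma pm_space_interval_sum:
  "pm_space (pm_direct_sum {(p, i). i < count {#(b, d)#} p} (\<lambda>(p, i :: nat). interval_module p)) r
     = ({((b, d), 0)} \<rightarrow>\<^sub>E (if r \<in> {b..<d} then UNIV else {0 :: 'f::field}))"
proof -
  have index: "{(p, i). i < count {#(b, d)#} p} = {((b, d), 0)}"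
    by (auto split: if_splits)
  show ?thesis
    unfolding index pm_direct_sum_def persistence_module.simps
    by (rule PiE_cong) (auto simp: interval_module_def)
qed

text \<open>Otherwise the homology at \<open>r\<close> has one element, whereas the interval module
  has the whole field there: the bijection would identify the vectors with entries 0 and 1.\<close>

lemma has_diagram_four_cycle:
  fixes Y :: "'a::metric_space set"
  assumes "has_diagram (VR_persistence 1 Y :: ('f::field, ('a list \<Rightarrow> 'f) set) persistence_module)
      {#(b, d)#}"
    and Y: "finite Y" "card Y \<le> 4" and r: "b \<le> r" "r < d"
  shows "four_cycle Y r"
proof (rule ccontr)
  assume "\<not> four_cycle Y r"
  have r0: "0 \<le> r"
    using assms by (auto simp: has_diagram_def)
  let ?N = "pm_direct_sum {(p, i). i < count {#(b, d)#} p} (\<lambda>(p, i :: nat). interval_module p)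
    :: ('f, (real \<times> real) \<times> nat \<Rightarrow> 'f) persistence_module"
  obtain \<phi> :: "('a list \<Rightarrow> 'f) set \<Rightarrow> (real \<times> real) \<times> nat \<Rightarrow> 'f"
    where bij: "bij_betw \<phi> (reduced_homology (VR Y r) 1) (pm_space ?N r)"
    using assms(1) r0 by (fastforce simp: has_diagram_def pm_isomorphic_def VR_persistence_def)
  have hom: "reduced_homology (VR Y r) 1 = {cycles (VR Y r) 1 :: ('a list \<Rightarrow> 'f) set}"
    by (intro reduced_homology_trivial cycles_subset_boundaries Y r0 \<open>\<not> four_cycle Y r\<close>)
  have h: "pm_space ?N r = {\<phi> (cycles (VR Y r) 1)}"
    using bij_betw_imp_surj_on[OF bij] unfolding hom image_insert image_empty by (rule sym)
  have mem: "(\<lambda>i\<in>{((b, d), 0)}. x) \<in> pm_space ?N r" for x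
    unfolding pm_space_interval_sum using r by auto
  have "(\<lambda>i\<in>{((b, d), 0)}. x) = \<phi> (cycles (VR Y r) 1)" for x
    using mem[of x] unfolding h by (rule singletonD)
  from fun_cong[OF this, of 0 "((b, d), 0)"] fun_cong[OF this, of 1 "((b, d), 0)"] show False
    by simp
qed

lemma four_cycle_obtain:
  assumes "four_cycle Y r" "0 \<le> r"
  obtains p q s t where "Y = {p, q, s, t}" "r < dist p s" "r < dist q t"
    "dist p q \<le> r" "dist q s \<le> r" "dist s t \<le> r" "dist t p \<le> r"
proof -
  have card: "card Y = 4" and uniq: "\<And>x. x \<in> Y \<Longrightarrow> \<exists>!y. y \<in> Y \<and> r < dist x y"
    using assms by (auto simp: four_cycle_def)
  then have fin: "finite Y" and "Y \<noteq> {}"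
    by (auto intro: card_ge_0_finite)
  then obtain p where p: "p \<in> Y"
    by blast
  obtain s where s: "s \<in> Y" "r < dist p s"
    using uniq[OF p] by blast
  have "p \<noteq> s"
    using s assms(2) by auto
  then have "card (Y - {p, s}) = 2"
    using fin card p s by (simp add: card_Diff_subset)
  then obtain q t where qt: "Y - {p, s} = {q, t}" "q \<noteq> t"
    by (auto simp: card_2_iff)
  then have q: "q \<in> Y" "q \<noteq> p" "q \<noteq> s" and t: "t \<in> Y" "t \<noteq> p" "t \<noteq> s"
    by blast+
  have pq: "dist p q \<le> r" and pt: "dist p t \<le> r"
    using uniq[OF p] q t s not_le by metis+
  have sq: "dist s q \<le> r" and st: "dist s t \<le> r"
    using uniq[OF s(1)] q t s p by (metis not_le dist_commute)+
  obtain y where y: "y \<in> Y" "r < dist q y"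
    using uniq[OF q(1)] by blast
  have Y: "Y = {p, q, s, t}"
    using qt p s by blast
  \<comment> \<open>The far point \<open>y\<close> of \<open>q\<close> is neither \<open>q\<close>
    itself nor one of its neighbours \<open>p\<close> and \<open>s\<close>, so only \<open>t\<close>
    is left; this gives the second diagonal.\<close>
  have "y = t"
    using y pq sq assms(2) unfolding Y by (auto simp: dist_commute)
  then show thesis
    using that[of p q s t] Y y s pq pt sq st by (simp add: dist_commute)
qed

section \<open>Persistence of a quadrilateral whose diagonals exceed its sides\<close>

locale four_points =
  fixes p q s t :: "'a::metric_space" and b d :: real
  assumes sides: "max (max (dist p q) (dist q s)) (max (dist s t) (dist t p)) = b"
    and diagonals: "min (dist p s) (dist q t) = d"
    and less: "b < d"
begin

abbreviation Y where "Y \<equiv> {p, q, s, t}"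

lemma dists: "dist p q \<le> b" "dist q s \<le> b" "dist s t \<le> b" "dist t p \<le> b"
    "d \<le> dist p s" "d \<le> dist q t"
  using sides diagonals by auto

lemma b_nonneg: "0 \<le> b"
  using dists(1) zero_le_dist[of p q] by linarith

text \<open>Identifying two consecutive vertices would make a side equal to a diagonal, against
  \<open>b < d\<close>; opposite vertices have positive distance.\<close>

lemma distinct_points: "p \<noteq> q" "p \<noteq> s" "p \<noteq> t" "q \<noteq> s" "q \<noteq> t" "s \<noteq> t"
  using dists less b_nonneg by (auto simp: dist_commute)

text \<open>Below \<open>d\<close> neither diagonal is an edge, so every edge joins
  \<open>{p, s}\<close> to \<open>{q, t}\<close>, and a bipartite graph has no triangle.\<close>

lemma no_triangles:
  assumes "0 \<le> r" "r < d" "c \<in> chains (VR Y r) 3"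
  shows "c = (\<lambda>_. 0 :: 'f::field)"
proof (rule ext, rule ccontr)
  fix xs assume nz: "c xs \<noteq> 0"
  then obtain x y z where xs: "xs = [x, y, z]"
    using chains_support(1)[OF assms(3) nz] by (auto simp: length_Suc_conv numeral_3_eq_3)
  have "x \<in> Y" "y \<in> Y" "z \<in> Y" "dist x y \<le> r" "dist y z \<le> r" "dist z x \<le> r"
    using chains_VR_dist[OF assms(3) _ assms(1) nz] unfolding xs by auto
  moreover have "x \<noteq> y" "y \<noteq> z" "z \<noteq> x"
    using chains_support(2)[OF assms(3) nz] unfolding xs by auto
  moreover have "u \<in> {p, s} \<longleftrightarrow> v \<notin> {p, s}" if "u \<in> Y" "v \<in> Y" "u \<noteq> v" "dist u v \<le> r" for u v
  proof -
    have "\<not> dist p s \<le> r" "\<not> dist s p \<le> r" "\<not> dist q t \<le> r" "\<not> dist t q \<le> r"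
      using assms dists by (simp_all add: dist_commute)
    then show ?thesis
      using that by blast
  qed
  ultimately show False
    by meson
qed

lemma boundaries_zero:
  assumes "0 \<le> r" "r < d"
  shows "boundaries (VR Y r) 1 = {\<lambda>_. 0 :: 'f::field}"
proof -
  have "chains (VR Y r) 3 = {\<lambda>_. 0 :: 'f}"
    using no_triangles[OF assms] zero_mem_chains[of "VR Y r" 3] by blast
  then show ?thesis
    by (simp add: boundaries_def numeral_3_eq_3 boundary_def)
qed

text \<open>Identifies classes with cycles below \<open>d\<close>, so that a class can later be
  evaluated on an edge.\<close>

lemma homology_class_singleton:
  fixes c :: "'a list \<Rightarrow> 'f::field"
  assumes "0 \<le> r" "r < d" "c \<in> cycles (VR Y r) 1"
  shows "homology_class (VR Y r) 1 c = {c}"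
proof -
  have "c' = c" if "c' \<in> cycles (VR Y r) 1" "(\<lambda>xs. c' xs - c xs) = (\<lambda>_. 0)" for c'
    using that by (simp add: fun_eq_iff)
  then show ?thesis
    using assms unfolding homology_class_def boundaries_zero[OF assms(1,2)] by auto
qed

text \<open>The diagonals are not edges, so at each vertex only the two incident sides enter the
  cycle condition, and the value is carried around the quadrilateral.\<close>

lemma cycle_values:
  fixes c :: "'a list \<Rightarrow> 'f::field"
  assumes "c \<in> cycles (VR Y r) 1" "0 \<le> r" "r < d"
  shows "c [p, q] = c [q, s]" "c [s, t] = c [q, s]" "c [t, p] = c [q, s]"
    and "c [p, s] = 0" "c [q, t] = 0"
proof -
  have c: "c \<in> chains (VR Y r) 2"
    using assms by (simp add: cycles_def numeral_2_eq_2)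
  have "(\<Sum>x\<in>Y. c [x, y]) = 0" for y
    using assms by (simp add: cycles_def boundary_VR[of Y] fun_eq_iff del: sum.insert)
  then have sum: "c [p, y] + c [q, y] + c [s, y] + c [t, y] = 0" for y
    using distinct_points by (simp add: add.assoc)
  have diag: "c [x, x] = 0" for x
    using chains_support(2)[OF c, of "[x, x]"] by auto
  show ps: "c [p, s] = 0"
    using chains_VR_dist(2)[OF c _ assms(2), of "[p, s]" p s] dists(5) assms by force
  show qt: "c [q, t] = 0"
    using chains_VR_dist(2)[OF c _ assms(2), of "[q, t]" q t] dists(6) assms by force
  have sp: "c [s, p] = 0" and tq: "c [t, q] = 0"
    using chains_2_swap[OF c, of s p] chains_2_swap[OF c, of t q] ps qt by auto
  show "c [p, q] = c [q, s]"
    using sum[of q] diag[of q] tq chains_2_swap[OF c, of q s] by (simp add: add_eq_0_iff)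
  show "c [s, t] = c [q, s]"
    using sum[of s] diag[of s] ps chains_2_swap[OF c, of s t] by (simp add: add_eq_0_iff)
  show "c [t, p] = c [q, s]"
    using sum[of p] diag[of p] sp chains_2_swap[OF c, of p q] \<open>c [p, q] = c [q, s]\<close>
    by (simp add: add_eq_0_iff)
qed

text \<open>The value on one side determines a cycle: a difference of two cycles that vanishes on
  \<open>[p, q]\<close> vanishes on all edges by \<open>cycle_values\<close>.\<close>

lemma cycles_eqI:
  fixes c :: "'a list \<Rightarrow> 'f::field"
  assumes "c \<in> cycles (VR Y r) 1" "c' \<in> cycles (VR Y r) 1" "0 \<le> r" "r < d" "c [p, q] = c' [p, q]"
  shows "c = c'"
proof (rule ext, rule ccontr)
  define e where "e = (\<lambda>xs. c xs - c' xs)"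
  fix xs assume "c xs \<noteq> c' xs"
  then have nz: "e xs \<noteq> 0"
    by (simp add: e_def)
  have cyc: "e \<in> cycles (VR Y r) 1"
    unfolding e_def using assms cycles_diff by blast
  then have e: "e \<in> chains (VR Y r) 2"
    by (simp add: cycles_def numeral_2_eq_2)
  obtain x y where xs: "xs = [x, y]"
    using chains_support(1)[OF e nz] by (auto simp: length_Suc_conv numeral_2_eq_2)
  then have xy: "x \<in> Y" "y \<in> Y" "x \<noteq> y"
    using chains_VR_dist(1)[OF e _ assms(3) nz] chains_support(2)[OF e nz] by auto
  have pq: "e [p, q] = 0"
    using assms(5) by (simp add: e_def)
  note vals = cycle_values[OF cyc assms(3,4)]
  have "e [q, s] = 0" "e [s, t] = 0" "e [t, p] = 0" "e [p, s] = 0" "e [q, t] = 0"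
    using vals pq by simp_all
  \<comment> \<open>The values above cover each unordered pair in one orientation only.\<close>
  then have "e [x, y] = 0 \<or> e [y, x] = 0"
    using xy pq by auto
  then show False
    using nz xs chains_2_swap[OF e, of x y] by auto
qed

lemma cycle_exists:
  assumes "b \<le> r"
  shows "\<exists>c \<in> cycles (VR Y r) 1. c [p, q] = (\<alpha> :: 'f::field)"
proof -
  \<comment> \<open>The sides are oriented around the quadrilateral: every vertex has one incoming
    and one outgoing edge, so their contributions to the boundary cancel.\<close>
  define E where "E = {(p, q), (q, s), (s, t), (t, p)}"
  define c where "c = (\<lambda>xs. case xs of
    [x, y] \<Rightarrow> if (x, y) \<in> E then \<alpha> else if (y, x) \<in> E then - \<alpha> else 0 | _ \<Rightarrow> 0)"
  have r0: "0 \<le> r"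
    using assms b_nonneg by simp
  have asym: "(y, x) \<notin> E" if "(x, y) \<in> E" for x y
    using that distinct_points unfolding E_def by auto
  have "length xs = 2 \<and> distinct xs \<and> set xs \<in> insert {} (VR Y r)" if nz: "c xs \<noteq> 0" for xs
  proof -
    obtain x y where xs: "xs = [x, y]" and xy: "(x, y) \<in> E \<or> (y, x) \<in> E"
      using nz by (auto simp: c_def split: list.splits if_splits)
    have "x \<noteq> y" "x \<in> Y" "y \<in> Y" "dist x y \<le> r"
      using xy distinct_points dists assms unfolding E_def by (auto simp: dist_commute)
    then show ?thesis
      using r0 xs by (simp add: mem_VR_iff dist_commute)
  qed
  moreover have "c (us @ x # y # vs) = - c (us @ y # x # vs)" for us x y vs
  proof (cases "us = [] \<and> vs = []")
    case True
    then show ?thesis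
      using asym[of x y] asym[of y x] by (auto simp: c_def)
  next
    case False
    then have "length (us @ x # y # vs) \<noteq> 2"
      by auto
    moreover have "c xs = 0" if "length xs \<noteq> 2" for xs
      using that by (auto simp: c_def split: list.splits)
    ultimately show ?thesis
      by simp
  qed
  ultimately have "c \<in> chains (VR Y r) 2"
    unfolding chains_def by blast
  moreover have "(\<Sum>v\<in>Y. c (v # xs)) = 0" for xs
  proof (cases "\<exists>y. xs = [y]")
    case True
    then obtain y where "xs = [y]" ..
    then show ?thesis
      using distinct_points by (auto simp: c_def E_def)
  next
    case False
    then have "c (v # xs) = 0" for v
      by (auto simp: c_def split: list.splits)
    then show ?thesis
      by simp
  qed
  ultimately have "c \<in> cycles (VR Y r) 1"
    using r0 by (simp add: cycles_def numeral_2_eq_2 boundary_VR[of Y] del: sum.insert)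
  moreover have "c [p, q] = \<alpha>"
    by (simp add: c_def E_def)
  ultimately show ?thesis
    by blast
qed

text \<open>If \<open>r < b\<close>, both diagonals and some side are longer than \<open>r\<close>,
  which gives a vertex two far points. If \<open>d <= r\<close>, an endpoint of a short diagonal has
  no far point.\<close>

lemma four_cycle_bounds:
  assumes "four_cycle Y r"
  shows "b \<le> r" "r < d"
proof -
  have uniq: "\<exists>!y. y \<in> Y \<and> r < dist x y" if "x \<in> Y" for x
    using assms that unfolding four_cycle_def by blast
  have eq: "y = y'" if "x \<in> Y" "y \<in> Y" "y' \<in> Y" "r < dist x y" "r < dist x y'" for x y y'
    using uniq[of x] that by blast
  show "b \<le> r"
  proof (rule ccontr)
    assume "\<not> b \<le> r"
    then have far: "r < dist p s" "r < dist q t" "r < dist s p" "r < dist t q"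
      using dists less by (simp_all add: dist_commute)
    have "r < dist p q \<or> r < dist q s \<or> r < dist s t \<or> r < dist t p"
      using \<open>\<not> b \<le> r\<close> sides by (auto simp: less_max_iff_disj)
    moreover have "s = q" if "r < dist p q"
      using eq[of p s q] far that by simp
    moreover have "t = s" if "r < dist q s"
      using eq[of q t s] far that by simp
    moreover have "p = t" if "r < dist s t"
      using eq[of s p t] far that by simp
    moreover have "q = p" if "r < dist t p"
      using eq[of t q p] far that by simp
    ultimately show False
      using distinct_points by metis
  qed
  show "r < d"
  proof (rule ccontr)
    assume "\<not> r < d"
    then have "\<not> r < dist p s \<or> \<not> r < dist q t"
      using diagonals by (auto simp: min_def split: if_splits)
    moreover have "\<not> r < dist p p" "\<not> r < dist p q" "\<not> r < dist p t"
      "\<not> r < dist q q" "\<not> r < dist q p" "\<not> r < dist q s"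
      using dists b_nonneg \<open>b \<le> r\<close> by (simp_all add: dist_commute)
    ultimately show False
      using uniq[of p] uniq[of q] by blast
  qed
qed

lemma reduced_homology_outside:
  assumes "0 \<le> r" "\<not> (b \<le> r \<and> r < d)"
  shows "reduced_homology (VR Y r) 1 = {cycles (VR Y r) 1 :: ('a list \<Rightarrow> 'f::field) set}"
proof -
  have "card Y \<le> 4"
    using card_length[of "[p, q, s, t]"] by simp
  then show ?thesis
    using four_cycle_bounds assms
    by (intro reduced_homology_trivial cycles_subset_boundaries) auto
qed

lemma has_diagram_VR:
  "has_diagram (VR_persistence 1 Y :: ('f::field, ('a list \<Rightarrow> 'f) set) persistence_module) {#(b, d)#}"
proof -
  let ?M = "VR_persistence 1 Y :: ('f, ('a list \<Rightarrow> 'f) set) persistence_module"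
  define I :: "((real \<times> real) \<times> nat) set" where "I = {((b, d), 0)}"
  have I: "{(p, i). i < count {#(b, d)#} p} = I"
    by (auto simp: I_def split: if_splits)
  let ?N = "pm_direct_sum I (\<lambda>(p, i :: nat). interval_module p)
    :: ('f, (real \<times> real) \<times> nat \<Rightarrow> 'f) persistence_module"
  \<comment> \<open>On the interval, \<open>the_elem\<close> returns the unique cycle in a class,
    and its value on \<open>[p, q]\<close> is the coordinate. Elsewhere both spaces have one
    element.\<close>
  define \<phi> :: "real \<Rightarrow> ('a list \<Rightarrow> 'f) set \<Rightarrow> (real \<times> real) \<times> nat \<Rightarrow> 'f" where
    "\<phi> r A = (\<lambda>i\<in>I. if b \<le> r \<and> r < d then the_elem A [p, q] else 0)" for r A
  have class_in: "homology_class (VR Y r) 1 c = {c}"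
    if "0 \<le> r" "r < d" "c \<in> cycles (VR Y r) 1" for r and c :: "'a list \<Rightarrow> 'f"
    using homology_class_singleton that by blast
  \<comment> \<open>Also valid for \<open>r < b\<close>, where a structure map into the interval may
    start.\<close>
  have space_in: "reduced_homology (VR Y r) 1 = (\<lambda>c. {c}) ` (cycles (VR Y r) 1 :: ('a list \<Rightarrow> 'f) set)"
    if "0 \<le> r" "r < d" for r
    unfolding reduced_homology_def using class_in[OF that] by (intro image_cong) auto
  have N_space: "pm_space ?N r = (I \<rightarrow>\<^sub>E (if b \<le> r \<and> r < d then UNIV else {0}))" for r
    using pm_space_interval_sum[of b d r, where ?'f = 'f] unfolding I by (simp add: I_def)
  have bij: "bij_betw (\<phi> r) (pm_space ?M r) (pm_space ?N r)" if r: "0 \<le> r" for r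
  proof (cases "b \<le> r \<and> r < d")
    case True
    show ?thesis
    proof (rule bij_betwI')
      fix A B assume "A \<in> pm_space ?M r" "B \<in> pm_space ?M r"
      then obtain c c' where c: "A = {c}" "B = {c'}" "c \<in> cycles (VR Y r) 1" "c' \<in> cycles (VR Y r) 1"
        using True r by (auto simp: VR_persistence_def space_in simp del: One_nat_def)
      have "c = c'" if "\<phi> r A = \<phi> r B"
        using fun_cong[OF that, of "((b, d), 0)"] c True r
        by (intro cycles_eqI[of c r c']) (auto simp: \<phi>_def I_def)
      then show "(\<phi> r A = \<phi> r B) = (A = B)"
        using c by auto
    next
      fix A
      show "\<phi> r A \<in> pm_space ?N r"
        using True by (simp add: N_space \<phi>_def)
    next
      fix h assume h: "h \<in> pm_space ?N r"
      obtain c where c: "c \<in> cycles (VR Y r) 1" "c [p, q] = h ((b, d), 0)"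
        using cycle_exists True by blast
      have "h = \<phi> r {c}"
        using h c True unfolding N_space
        by (auto simp: \<phi>_def I_def PiE_def extensional_def fun_eq_iff restrict_def)
      then show "\<exists>A\<in>pm_space ?M r. h = \<phi> r A"
        using c True r by (auto simp: VR_persistence_def space_in simp del: One_nat_def)
    qed
  next
    case False
    have "pm_space ?N r = (I \<rightarrow>\<^sub>E {0})"
      using False by (simp only: N_space if_False)
    also have "\<dots> = {\<lambda>i\<in>I. 0}"
      by (simp only: I_def PiE_over_singleton_iff UN_insert UN_empty Un_empty_right)
    finally have "pm_space ?N r = {\<lambda>i\<in>I. 0}" .
    moreover have "pm_space ?M r = {cycles (VR Y r) 1}"
      using reduced_homology_outside[OF r False] by (simp add: VR_persistence_def del: One_nat_def)
    moreover have "\<phi> r A = (\<lambda>i\<in>I. 0)" for A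
      using False by (auto simp: \<phi>_def)
    ultimately show ?thesis
      by (auto simp: bij_betw_def)
  qed
  have add: "\<phi> r (pm_add ?M r A B) = pm_add ?N r (\<phi> r A) (\<phi> r B)"
    if r: "0 \<le> r" and A: "A \<in> pm_space ?M r" "B \<in> pm_space ?M r" for r A B
  proof (cases "b \<le> r \<and> r < d")
    case True
    then obtain c c' where c: "A = {c}" "B = {c'}" "c \<in> cycles (VR Y r) 1" "c' \<in> cycles (VR Y r) 1"
      using r A by (auto simp: VR_persistence_def space_in simp del: One_nat_def)
    then have "pm_add ?M r A B = {\<lambda>xs. c xs + c' xs}"
      using class_in[OF r _ cycles_add] True by (simp add: VR_persistence_def del: One_nat_def)
    then show ?thesis
      using c True
      by (auto simp: \<phi>_def pm_direct_sum_def interval_module_def restrict_def fun_eq_iff I_def)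
  next
    case False
    then show ?thesis
      by (auto simp: \<phi>_def pm_direct_sum_def interval_module_def restrict_def fun_eq_iff I_def)
  qed
  have scale: "\<phi> r (pm_scale ?M r a A) = pm_scale ?N r a (\<phi> r A)"
    if r: "0 \<le> r" and A: "A \<in> pm_space ?M r" for r a A
  proof (cases "b \<le> r \<and> r < d")
    case True
    then obtain c where c: "A = {c}" "c \<in> cycles (VR Y r) 1"
      using r A by (auto simp: VR_persistence_def space_in simp del: One_nat_def)
    then have "pm_scale ?M r a A = {\<lambda>xs. a * c xs}"
      using class_in[OF r _ cycles_scale] True by (simp add: VR_persistence_def del: One_nat_def)
    then show ?thesis
      using c True
      by (auto simp: \<phi>_def pm_direct_sum_def interval_module_def restrict_def fun_eq_iff I_def)
  next
    case False
    then show ?thesis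
      by (auto simp: \<phi>_def pm_direct_sum_def interval_module_def restrict_def fun_eq_iff I_def)
  qed
  have map: "\<phi> r' (pm_map ?M r r' A) = pm_map ?N r r' (\<phi> r A)"
    if r: "0 \<le> r" "r \<le> r'" and A: "A \<in> pm_space ?M r" for r r' A
  \<comment> \<open>Only the target scale matters for this split: if it lies outside the interval,
    both sides are zero.\<close>
  proof (cases "b \<le> r' \<and> r' < d")
    case True
    then have r'd: "r < d" "r' < d" "0 \<le> r'"
      using r by auto
    obtain c where c: "A = {c}" "c \<in> cycles (VR Y r) 1"
      using A r r'd by (auto simp: VR_persistence_def space_in simp del: One_nat_def)
    then have "c \<in> cycles (VR Y r') 1"
      using cycles_VR_mono[of Y r r'] r by auto
    then have "pm_map ?M r r' A = {c}"
      using c class_in r'd by (simp add: VR_persistence_def del: One_nat_def)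
    \<comment> \<open>The interval module maps to zero from scales below \<open>b\<close>. There the
      homology has a single element, so the only cycle is the zero cycle.\<close>
    moreover have "c [p, q] = 0" if "\<not> b \<le> r"
    proof -
      have c_only: "cycles (VR Y r) 1 = {c}"
        using reduced_homology_outside[of r, where ?'f = 'f] that r A c
        by (auto simp: VR_persistence_def simp del: One_nat_def)
      have "(\<lambda>_. 0) \<in> {c}"
        unfolding c_only[symmetric] by (rule zero_mem_cycles)
      then show ?thesis
        by auto
    qed
    ultimately show ?thesis
      using c True r'd
      by (auto simp: \<phi>_def pm_direct_sum_def interval_module_def restrict_def fun_eq_iff I_def)
  next
    case False
    then show ?thesis
      by (auto simp: \<phi>_def pm_direct_sum_def interval_module_def restrict_def fun_eq_iff I_def)
  qed
  have "pm_isomorphic ?M ?N"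
    unfolding pm_isomorphic_def using bij add scale map by (intro exI[of _ \<phi>]) blast
  then show ?thesis
    using b_nonneg less unfolding has_diagram_def I by simp
qed

end

section \<open>Quadrilaterals in Euclidean space\<close>

text \<open>Euler's quadrilateral identity: the defect is the squared norm of
  \<open>p - q + s - t\<close>, which vanishes exactly for parallelograms.\<close>

lemma quadrilateral_inequality:
  fixes p q s t :: "'a::real_inner"
  shows "(dist p s)\<^sup>2 + (dist q t)\<^sup>2 \<le> (dist p q)\<^sup>2 + (dist q s)\<^sup>2 + (dist s t)\<^sup>2 + (dist t p)\<^sup>2"
proof -
  have "(dist p q)\<^sup>2 + (dist q s)\<^sup>2 + (dist s t)\<^sup>2 + (dist t p)\<^sup>2 - (dist p s)\<^sup>2 - (dist q t)\<^sup>2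
      = (norm (p - q + s - t))\<^sup>2"
    unfolding dist_norm power2_norm_eq_inner
    by (simp add: inner_diff_left inner_diff_right inner_add_left inner_add_right inner_commute)
  then show ?thesis
    using zero_le_power2[of "norm (p - q + s - t)"] by linarith
qed

lemma D_VR_4_1_bounds:
  fixes X :: "'a::real_inner set"
  assumes "(b, d) \<in> D_VR_4_1 TYPE('f::field) X"
  shows "0 < b" "b < d" "d \<le> sqrt 2 * b" "\<exists>x\<in>X. \<exists>y\<in>X. d \<le> dist x y"
proof -
  obtain Y where Y: "Y \<subseteq> X" "finite Y" "card Y \<le> 4"
    and dgm: "has_diagram (VR_persistence 1 Y :: ('f, ('a list \<Rightarrow> 'f) set) persistence_module)
      {#(b, d)#}"
    using assms by (auto simp: D_VR_4_1_def VR_diagrams_def)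
  have bd: "0 \<le> b" "b < d"
    using dgm by (auto simp: has_diagram_def)
  note four = has_diagram_four_cycle[OF dgm Y(2,3)]
  obtain p q s t where pqst: "Y = {p, q, s, t}" "b < dist p s" "b < dist q t"
      and side: "dist p q \<le> b" "dist q s \<le> b" "dist s t \<le> b" "dist t p \<le> b"
    using four_cycle_obtain[OF four[OF order_refl bd(2)] bd(1)] by metis
  \<comment> \<open>A diagonal shorter than \<open>d\<close> would itself be a scale in the
    interval, and at that scale \<open>p\<close> has no strictly farther point.\<close>
  have ps: "d \<le> dist p s"
  proof (rule ccontr)
    assume "\<not> d \<le> dist p s"
    then have "four_cycle Y (dist p s)"
      using pqst(2) by (intro four) auto
    then obtain y where "y \<in> Y" "dist p s < dist p y"
      using pqst(1) unfolding four_cycle_def by blast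
    then show False
      using pqst side by (auto simp: dist_commute)
  qed
  have qt: "d \<le> dist q t"
  proof (rule ccontr)
    assume "\<not> d \<le> dist q t"
    then have "four_cycle Y (dist q t)"
      using pqst(3) by (intro four) auto
    then obtain y where "y \<in> Y" "dist q t < dist q y"
      using pqst(1) unfolding four_cycle_def by blast
    then show False
      using pqst side by (auto simp: dist_commute)
  qed
  have "d\<^sup>2 + d\<^sup>2 \<le> (dist p s)\<^sup>2 + (dist q t)\<^sup>2"
    using ps qt bd by (intro add_mono power_mono) auto
  also have "\<dots> \<le> b\<^sup>2 + b\<^sup>2 + b\<^sup>2 + b\<^sup>2"
    using side by (intro order_trans[OF quadrilateral_inequality] add_mono power_mono) auto
  finally have "d\<^sup>2 \<le> (sqrt 2 * b)\<^sup>2"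
    by (simp add: power_mult_distrib)
  then show "d \<le> sqrt 2 * b"
    using bd by (simp add: power2_le_iff_abs_le)
  \<comment> \<open>The diagram only gives \<open>0 <= b\<close>; the value \<open>b = 0\<close>
    would force \<open>d <= 0\<close>, against \<open>b < d\<close>.\<close>
  then show "0 < b" "b < d"
    using bd by (auto simp: less_le)
  show "\<exists>x\<in>X. \<exists>y\<in>X. d \<le> dist x y"
    using ps pqst Y by blast
qed

text \<open>A rectangle with diagonal \<open>d\<close> is inscribed in a circle of radius
  \<open>d / 2\<close>, so it is enough that \<open>X\<close> contains such a circle. This covers
  flat space and the sphere alike.\<close>

lemma rectangle_mem_D_VR_4_1:
  fixes X :: "'a::real_inner set" and c u v :: 'a
  assumes bd: "0 < b" "b < d" "d \<le> sqrt 2 * b"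
    and uv: "norm u = 1" "norm v = 1" "u \<bullet> v = 0"
    and X: "\<And>x y. x\<^sup>2 + y\<^sup>2 = (d / 2)\<^sup>2 \<Longrightarrow> c + x *\<^sub>R u + y *\<^sub>R v \<in> X"
  shows "(b, d) \<in> D_VR_4_1 TYPE('f::field) X"
proof -
  define P where "P x y = c + x *\<^sub>R u + y *\<^sub>R v" for x y
  \<comment> \<open>The other side of the rectangle, by Pythagoras; the bound
    \<open>d <= sqrt 2 * b\<close> says exactly that it is not the longer one.\<close>
  define e where "e = sqrt (d\<^sup>2 - b\<^sup>2)"
  have "b\<^sup>2 \<le> d\<^sup>2"
    using bd by (intro power_mono) auto
  then have e: "0 \<le> e" "e\<^sup>2 = d\<^sup>2 - b\<^sup>2"
    by (simp_all add: e_def)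
  have "d\<^sup>2 \<le> (sqrt 2 * b)\<^sup>2"
    using bd by (intro power_mono) auto
  then have "e\<^sup>2 \<le> b\<^sup>2"
    by (simp add: e power_mult_distrib)
  then have eb: "e \<le> b"
    by (rule power2_le_imp_le) (use bd in simp)
  have dist_P: "dist (P x y) (P x' y') = sqrt ((x - x')\<^sup>2 + (y - y')\<^sup>2)" for x y x' y'
  proof -
    have "P x y - P x' y' = (x - x') *\<^sub>R u + (y - y') *\<^sub>R v"
      by (simp add: P_def algebra_simps)
    moreover have "(norm ((x - x') *\<^sub>R u + (y - y') *\<^sub>R v))\<^sup>2 = (x - x')\<^sup>2 + (y - y')\<^sup>2"
      using uv by (subst norm_add_Pythagorean) (simp_all add: orthogonal_def)
    ultimately show ?thesis
      by (metis dist_norm norm_ge_zero real_sqrt_unique)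
  qed
  let ?p = "P (b / 2) (e / 2)" and ?q = "P (- b / 2) (e / 2)"
    and ?s = "P (- b / 2) (- e / 2)" and ?t = "P (b / 2) (- e / 2)"
  have diagonal: "sqrt (b\<^sup>2 + e\<^sup>2) = d"
    using bd e(2) by simp
  have dists: "dist ?p ?q = b" "dist ?q ?s = e" "dist ?s ?t = b" "dist ?t ?p = e"
      "dist ?p ?s = d" "dist ?q ?t = d"
    using bd(1) e(1) diagonal by (simp_all add: dist_P)
  interpret four_points ?p ?q ?s ?t b d
  proof
    show "max (max (dist ?p ?q) (dist ?q ?s)) (max (dist ?s ?t) (dist ?t ?p)) = b"
      unfolding dists using eb by (simp only: max.absorb1 max.idem)
    show "min (dist ?p ?s) (dist ?q ?t) = d"
      unfolding dists by (rule min.idem)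
  qed (rule bd(2))
  have "P x y \<in> X" if "x\<^sup>2 = (b / 2)\<^sup>2" "y\<^sup>2 = (e / 2)\<^sup>2" for x y
  proof -
    have "x\<^sup>2 + y\<^sup>2 = (d / 2)\<^sup>2"
      unfolding that power_divide e(2) by (simp add: diff_divide_distrib)
    then show ?thesis
      unfolding P_def by (rule X)
  qed
  then have "{?p, ?q, ?s, ?t} \<subseteq> X"
    by simp
  moreover have "card {?p, ?q, ?s, ?t} \<le> 4"
    using card_length[of "[?p, ?q, ?s, ?t]"] by simp
  ultimately show ?thesis
    unfolding D_VR_4_1_def VR_diagrams_def using has_diagram_VR by blast
qed

section \<open>The two diagram sets and their convexity\<close>

lemma D_VR_4_1_UNIV:
  assumes "CARD('n::finite) \<ge> 2"
  shows "D_VR_4_1 TYPE('f::field) (UNIV :: (real ^ 'n) set)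
    = {(b, d). 0 < b \<and> b < d \<and> d \<le> sqrt 2 * b}"
proof -
  obtain i j :: 'n where "i \<noteq> j"
    using assms by (metis card_2_iff' ex_card)
  then have "(b, d) \<in> D_VR_4_1 TYPE('f) (UNIV :: (real ^ 'n) set)"
    if "0 < b" "b < d" "d \<le> sqrt 2 * b" for b d
    using that by (intro rectangle_mem_D_VR_4_1[where u = "axis i 1" and v = "axis j 1" and c = 0])
      (auto simp: inner_axis_axis)
  then show ?thesis
    using D_VR_4_1_bounds by auto
qed

lemma D_VR_4_1_sphere:
  assumes "CARD('m::finite) \<ge> 3"
  shows "D_VR_4_1 TYPE('f::field) (sphere 0 1 :: (real ^ 'm) set)
    = {(b, d). 0 < b \<and> b < d \<and> d \<le> min (sqrt 2 * b) 2}"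
proof -
  obtain i j k :: 'm where ijk: "i \<noteq> j" "i \<noteq> k" "j \<noteq> k"
    using obtain_subset_with_card_n[OF assms] unfolding card_3_iff by metis
  have mem: "(b, d) \<in> D_VR_4_1 TYPE('f) (sphere 0 1 :: (real ^ 'm) set)"
    if bd: "0 < b" "b < d" "d \<le> sqrt 2 * b" "d \<le> 2" for b d
  proof -
    \<comment> \<open>The plane at height \<open>h\<close> along a third axis cuts the unit sphere
      in a circle of radius \<open>d / 2\<close>; the root is real because
      \<open>d <= 2\<close>.\<close>
    define h where "h = sqrt (1 - (d / 2)\<^sup>2)"
    have h: "h\<^sup>2 = 1 - (d / 2)\<^sup>2"
      unfolding h_def using bd by (simp add: power_le_one)
    show ?thesis
    proof (rule rectangle_mem_D_VR_4_1[OF bd(1-3)])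
      fix x y :: real assume xy: "x\<^sup>2 + y\<^sup>2 = (d / 2)\<^sup>2"
      let ?z = "h *\<^sub>R axis k 1 + x *\<^sub>R axis i 1 + y *\<^sub>R axis j 1 :: real ^ 'm"
      have "(norm ?z)\<^sup>2 = h\<^sup>2 + x\<^sup>2 + y\<^sup>2"
        using ijk unfolding power2_norm_eq_inner
        by (simp add: inner_add_left inner_add_right inner_axis_axis power2_eq_square)
      also have "\<dots> = 1"
        using h xy by simp
      finally show "?z \<in> sphere 0 1"
        by (simp add: power2_eq_1_iff) (smt (verit) norm_ge_zero)
    qed (use ijk in \<open>simp_all add: inner_axis_axis\<close>)
  qed
  \<comment> \<open>Some two points of the sphere are at distance at least \<open>d\<close>, and no
    chord is longer than 2.\<close>
  have le_2: "d \<le> 2" if bd: "(b, d) \<in> D_VR_4_1 TYPE('f) (sphere 0 1 :: (real ^ 'm) set)" for b d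
  proof -
    obtain x y :: "real ^ 'm" where "norm x = 1" "norm y = 1" "d \<le> dist x y"
      using D_VR_4_1_bounds(4)[OF bd] by auto
    then show ?thesis
      using norm_triangle_ineq4[of x y] by (simp add: dist_norm)
  qed
  have "(b, d) \<in> D_VR_4_1 TYPE('f) (sphere 0 1 :: (real ^ 'm) set)
      \<longleftrightarrow> 0 < b \<and> b < d \<and> d \<le> min (sqrt 2 * b) 2" for b d
    unfolding min.bounded_iff
    by (intro iffI conjI; (elim conjE)?)
      (fact D_VR_4_1_bounds(1-3) le_2 | rule mem; assumption)+
  then show ?thesis
    by auto
qed

text \<open>Each condition is linear in \<open>(b, d)\<close> and cuts out an open or closed
  half-plane.\<close>

lemma convex_wedge: "convex {(b, d). 0 < b \<and> b < d \<and> d \<le> c * b \<and> d \<le> (m :: real)}"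
proof -
  have "{(b, d). 0 < b \<and> b < d \<and> d \<le> c * b \<and> d \<le> m}
      = {x. (1, 0) \<bullet> x > 0} \<inter> {x. (1, -1) \<bullet> x < 0} \<inter> {x. (- c, 1) \<bullet> x \<le> 0} \<inter> {x. (0, 1) \<bullet> x \<le> m}"
    by auto
  then show ?thesis
    by (simp only:) (intro convex_Int convex_halfspace_gt convex_halfspace_lt convex_halfspace_le)
qed

theorem proposition5p17:
  assumes "CARD('n::finite) \<ge> 2"
    and "CARD('m::finite) = CARD('n) + 1"
  shows "D_VR_4_1 TYPE('f::field) (UNIV :: (real ^ 'n) set)
             = {(t_b, t_d). 0 < t_b \<and> t_b < t_d \<and> t_d \<le> sqrt 2 * t_b} \<and>
         D_VR_4_1 TYPE('f) (sphere 0 1 :: (real ^ 'm) set)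
             = {(t_b, t_d). 0 < t_b \<and> t_b < t_d \<and> t_d \<le> min (sqrt 2 * t_b) 2} \<and>
         convex (D_VR_4_1 TYPE('f) (UNIV :: (real ^ 'n) set)) \<and>
         convex (D_VR_4_1 TYPE('f) (sphere 0 1 :: (real ^ 'm) set))"
proof -
  have "{(b, d). 0 < b \<and> b < d \<and> d \<le> sqrt 2 * b}
      = {x. (1, 0) \<bullet> x > 0} \<inter> {x. (1, -1) \<bullet> x < 0} \<inter> {x. (- sqrt 2, 1) \<bullet> x \<le> 0}"
    by auto
  then have "convex {(b, d). 0 < b \<and> b < d \<and> d \<le> sqrt 2 * b}"
    by (simp only:) (intro convex_Int convex_halfspace_gt convex_halfspace_lt convex_halfspace_le)
  then show ?thesis
    using D_VR_4_1_UNIV[OF assms(1), where ?'f = 'f] D_VR_4_1_sphere[where ?'m = 'm and ?'f = 'f]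
      convex_wedge[of "sqrt 2" 2] assms by simp
qed

end
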